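(* Consider the large-data-arrival-energy-sufficient regime: $\overline{\lambda}$ and $\overline{\alpha}$ are sufficiently large and $E_1(1/\overline{\alpha})<\overline{\lambda}<\exp(1/x)E_1(1/x)$, where $x>0$ satisfies $x\exp(-1/x)-E_1(1/x)=\overline{\alpha}$. Let $e^{th}$ be the solution of $E_1(\tau/e^{th})=\overline{\lambda}$. Let $V(q,e)$ be the closed-form priority function of this regime: for $0<e<e^{th}$, $$V(q,e)=\frac{e^2}{4\overline{\lambda}\,\overline{\alpha}^2\tau}\Big(1+2\gamma_{eu}+2\overline{\lambda}-2\log\frac{e}{\tau}\Big)-\frac{eq}{\overline{\lambda}\,\overline{\alpha}\,\tau}+C_1,\qquad C_1=\frac{\tau}{4\overline{\lambda}}\big(1+2\gamma_{eu}+2\overline{\lambda}-2\log\overline{\alpha}\big),$$ and for $e\ge e^{th}$, $V(q,e)$ is a function of $q$ only. Then the power control $$p^\ast=\min\Big\{\Big(W(q,e)-\frac{1}{|h|^2}\Big)^+,\frac{e}{\tau}\Big\},\qquad W(q,e)=-\frac{\partial V(q,e)}{\partial q}\Big/\frac{\partial V(q,e)}{\partial e},$$ has the following structure: (1) When $0<e<e^{th}$ and $q>\frac{e}{\overline{\alpha}}\big(\gamma_{eu}+\overline{\lambda}-\log\frac{e}{\tau}\big)$, $p^\ast=0$. (2) When $0<e<\overline{\alpha}q$ and $q<\frac{e}{\overline{\alpha}}\big(\gamma_{eu}+\overline{\lambda}-\log\frac{e}{\tau}\big)$, the water level $W(q,e)$ is an increasing function of $q$ for given $e$, and a decreasing function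 of $e$ for given $q$. (3) When $\overline{\alpha}q<e<e^{th}$ and $q<\frac{e}{\overline{\alpha}}\big(\gamma_{eu}+\overline{\lambda}-\log\frac{e}{\tau}\big)$, the water level $W(q,e)$ is an increasing function of $q$ for given $e$, and an increasing function of $e$ for given $q$. (4) When $e\ge e^{th}$, $p^\ast=e/\tau$.
   Context: Here $q\ge0$ is the data queue length, $e\in[0,N_E]$ the energy queue length ($N_E>0$ the energy storage capacity), $h\in\mathbb{C}$ the channel coefficient, $\tau>0$ the slot duration, $\overline{\lambda}>0$ the mean data arrival rate and $\overline{\alpha}>0$ the mean energy arrival rate. $E_1(x)=\int_1^\infty\frac{e^{-tx}}{t}\,\mathrm{d}t$ is the exponential integral, $\gamma_{eu}$ is Euler's constant, $\log$ is the natural logarithm, $y^+=\max\{y,0\}$. Convention: when $\frac{\partial V}{\partial e}=0$, the water level $W$ is taken to be $+\infty$, so that $p^\ast=e/\tau$. *)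

theory Defs
  imports "HOL-Analysis.Analysis"
begin

definition E1 :: "real \<Rightarrow> real" where
  "E1 x = integral {1..} (\<lambda>t. exp (- (t * x)) / t)"

definition large_arrival_energy_sufficient :: "real \<Rightarrow> real \<Rightarrow> bool" where
  "large_arrival_energy_sufficient lam \<alpha> \<longleftrightarrow>
     (\<exists>x>0. x * exp (- 1 / x) - E1 (1 / x) = \<alpha> \<and>
            E1 (1 / \<alpha>) < lam \<and> lam < exp (1 / x) * E1 (1 / x))"

definition V_low :: "real \<Rightarrow> real \<Rightarrow> real \<Rightarrow> real \<Rightarrow> real \<Rightarrow> real" where
  "V_low lam \<alpha> \<tau> q e =
     e\<^sup>2 / (4 * lam * \<alpha>\<^sup>2 * \<tau>) * (1 + 2 * euler_mascheroni + 2 * lam - 2 * ln (e / \<tau>))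
     - e * q / (lam * \<alpha> * \<tau>)
     + \<tau> / (4 * lam) * (1 + 2 * euler_mascheroni + 2 * lam - 2 * ln \<alpha>)"

text \<open>On \<open>e \<ge> eth\<close> the only information on \<open>V\<close> is that it does not depend on \<open>e\<close>.\<close>

definition priority_function ::
  "real \<Rightarrow> real \<Rightarrow> real \<Rightarrow> real \<Rightarrow> (real \<Rightarrow> real \<Rightarrow> real) \<Rightarrow> bool" where
  "priority_function lam \<alpha> \<tau> eth V \<longleftrightarrow>
     (\<forall>q\<ge>0. \<forall>e. 0 < e \<and> e < eth \<longrightarrow> V q e = V_low lam \<alpha> \<tau> q e) \<and>
     (\<exists>g. \<forall>q\<ge>0. \<forall>e\<ge>eth. V q e = g q)"

text \<open>\<open>V\<close> is given piecewise, on \<open>0 < e < eth\<close> and on \<open>e \<ge> eth\<close>, and only for \<open>q \<ge> 0\<close>. At the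
  left end points \<open>e = eth\<close> and \<open>q = 0\<close> the derivatives of the pieces are one-sided (the two-sided
  derivative in \<open>e\<close> need not exist at \<open>eth\<close>), so partial derivatives are taken from the right.
  Wherever a function is differentiable this is its ordinary derivative, as shown below.\<close>

definition right_deriv :: "(real \<Rightarrow> real) \<Rightarrow> real \<Rightarrow> real" where
  "right_deriv f x = vector_derivative f (at x within {x..})"

lemma right_deriv_eqI:
  assumes "(f has_real_derivative D) (at x within {x..})"
  shows "right_deriv f x = D"
proof -
  have "at x within {x..} \<noteq> bot"
    by (simp add: at_within_Ici_at_right)
  then show ?thesis
    unfolding right_deriv_def
    by (rule vector_derivative_within)
      (use assms in \<open>simp add: has_real_derivative_iff_has_vector_derivative\<close>)
qed

lemma right_deriv_eq_deriv:
  assumes "f field_differentiable (at x)"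
  shows "right_deriv f x = deriv f x"
proof (rule right_deriv_eqI)
  show "(f has_real_derivative deriv f x) (at x within {x..})"
    using assms by (meson field_differentiable_derivI has_field_derivative_at_within)
qed

definition dV_dq :: "(real \<Rightarrow> real \<Rightarrow> real) \<Rightarrow> real \<Rightarrow> real \<Rightarrow> real" where
  "dV_dq V q e = right_deriv (\<lambda>q'. V q' e) q"

definition dV_de :: "(real \<Rightarrow> real \<Rightarrow> real) \<Rightarrow> real \<Rightarrow> real \<Rightarrow> real" where
  "dV_de V q e = right_deriv (\<lambda>e'. V q e') e"

definition water_level :: "(real \<Rightarrow> real \<Rightarrow> real) \<Rightarrow> real \<Rightarrow> real \<Rightarrow> ereal" where
  "water_level V q e =
     (if dV_de V q e = 0 then \<infinity> else ereal (- (dV_dq V q e / dV_de V q e)))"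

text \<open>If \<open>h = 0\<close>, the extended-real quotient is \<open>\<infinity>\<close>, so a finite water level gives power 0,
  while an infinite one gives \<open>e / \<tau>\<close> because \<open>\<infinity> - \<infinity> = \<infinity>\<close> in \<^typ>\<open>ereal\<close>.\<close>

definition power_control ::
  "(real \<Rightarrow> real \<Rightarrow> real) \<Rightarrow> real \<Rightarrow> complex \<Rightarrow> real \<Rightarrow> real \<Rightarrow> ereal" where
  "power_control V \<tau> h q e =
     min (max (water_level V q e - 1 / ereal ((cmod h)\<^sup>2)) 0) (ereal (e / \<tau>))"

definition critical_queue :: "real \<Rightarrow> real \<Rightarrow> real \<Rightarrow> real \<Rightarrow> real" where
  "critical_queue lam \<alpha> \<tau> e = e / \<alpha> * (euler_mascheroni + lam - ln (e / \<tau>))"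

end

theory Submission
  imports Defs
begin

text \<open>Below \<open>eth\<close> the water level equals \<open>1 / ((\<gamma> + lam - ln (e / \<tau>)) / \<alpha> - q / e)\<close>, where \<open>\<gamma>\<close> is Euler's
  constant. The denominator decreases in \<open>q\<close>, and in \<open>e\<close> it increases up to \<open>e = \<alpha> * q\<close> and decreases
  afterwards; this gives all monotonicity claims. Since part (2) does not mention \<open>eth\<close>, its region has
  to lie below \<open>eth\<close>: there \<open>\<gamma> + lam - ln (e / \<tau>) > 1\<close>, and \<open>E1 u \<le> 1 - \<gamma> - ln u\<close> for \<open>0 < u \<le> 1\<close>
  applied to \<open>u = \<tau> / eth\<close> yields \<open>e < eth\<close>. For \<open>lam \<ge> 1\<close> one has \<open>u \<le> 1\<close> because \<open>E1 < 1\<close> beyond \<open>1\<close>.\<close>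

section \<open>Upper bounds for the exponential integral\<close>

text \<open>\<open>integral\<close> is 0 on non-integrable functions, so with
  \<open>I \<ge> 0\<close> a majorant bounds \<open>E1\<close> without a separate integrability
  proof.\<close>

lemma integral_le_nonneg_has_integral:
  fixes f g :: "real \<Rightarrow> real"
  assumes "(g has_integral I) S" "\<And>x. x \<in> S \<Longrightarrow> f x \<le> g x" "I \<ge> 0"
  shows "integral S f \<le> I"
proof (cases "f integrable_on S")
  case True
  then show ?thesis
    using assms has_integral_le integrable_integral by blast
next
  case False
  then show ?thesis
    using assms(3) by (simp add: not_integrable_integral)
qed

text \<open>Dropping the factor \<open>1 / t\<close>, at most 1 on the range, leaves an exponential
  with integral \<open>exp (- u) / u\<close>.\<close>

lemma E1_less_one:
  assumes "u > 1"
  shows "E1 u < 1"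
proof -
  have "E1 u \<le> exp (- u * 1) / u"
    unfolding E1_def
  proof (rule integral_le_nonneg_has_integral)
    show "((\<lambda>t. exp (- u * t)) has_integral exp (- u * 1) / u) {1..}"
      using assms by (intro has_integral_exp_minus_to_infinity) simp
    show "exp (- (t * u)) / t \<le> exp (- u * t)" if "t \<in> {1..}" for t
      using that by (simp add: field_simps)
  qed (use assms in simp)
  also have "\<dots> < 1"
    using assms by (simp add: divide_less_eq order.strict_trans[of _ 1])
  finally show ?thesis .
qed

text \<open>Split at \<open>t = 1 / u\<close>: before it the exponential is bounded by 1, giving
  \<open>- ln u\<close>; after it \<open>1 / t\<close> is bounded by \<open>u\<close>, giving
  \<open>exp (- 1)\<close>.\<close>

lemma E1_le_exp_minus_ln:
  assumes "0 < u" "u \<le> 1"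
  shows "E1 u \<le> exp (- 1) - ln u"
proof -
  define g where "g t = (if t \<le> 1 / u then 1 / t else u * exp (- u * t))" for t
  have "((\<lambda>t. 1 / t) has_integral ln (1 / u) - ln 1) {1..1 / u}"
    using assms
    by (intro fundamental_theorem_of_calculus)
       (auto intro!: derivative_eq_intros
             simp: has_real_derivative_iff_has_vector_derivative [symmetric] field_simps)
  then have 1: "(g has_integral - ln u) {1..1 / u}"
    using assms by (subst has_integral_cong[of _ _ "\<lambda>t. 1 / t"]) (auto simp: g_def ln_div)
  have "((\<lambda>t. u * exp (- u * t)) has_integral u * (exp (- u * (1 / u)) / u)) {1 / u..}"
    using assms by (intro has_integral_mult_right has_integral_exp_minus_to_infinity)
  then have 2: "(g has_integral exp (- 1)) {1 / u..}"
    using assms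
    \<comment> \<open>At \<open>1 / u\<close> itself \<open>g\<close> takes its first branch; a
      single point does not affect the integral.\<close>
    by (intro has_integral_spike_finite[of "{1 / u}" _ g "\<lambda>t. u * exp (- u * t)"])
       (auto simp: g_def)
  have "(g has_integral - ln u + exp (- 1)) ({1..1 / u} \<union> {1 / u..})"
    using 1 2
    by (rule has_integral_Un) (auto intro: negligible_subset[of "{1 / u}"])
  moreover have "1 \<le> 1 / u"
    using assms by simp
  then have "{1..1 / u} \<union> {1 / u..} = {1..}"
    by auto
  ultimately have g: "(g has_integral - ln u + exp (- 1)) {1..}"
    by simp
  have "E1 u \<le> - ln u + exp (- 1)"
    unfolding E1_def
  proof (rule integral_le_nonneg_has_integral[OF g])
    fix t :: real
    assume t: "t \<in> {1..}"
    show "exp (- (t * u)) / t \<le> g t"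
    proof (cases "t \<le> 1 / u")
      case True
      then show ?thesis
        using t assms by (simp add: g_def divide_right_mono)
    next
      case False
      then have "1 / t \<le> u"
        using t assms by (simp add: field_simps)
      then have "1 / t * exp (- (t * u)) \<le> u * exp (- (t * u))"
        by (intro mult_right_mono) auto
      then show ?thesis
        using False by (simp add: g_def mult.commute)
    qed
  qed (use assms in \<open>simp add: order.trans[of _ 0]\<close>)
  then show ?thesis
    by simp
qed

lemma exp_minus_one_less: "exp (- 1) < 1 - (euler_mascheroni :: real)"
proof -
  \<comment> \<open>5/2 = 1 + 1 + 1/2 is the quadratic Taylor bound. It suffices narrowly: 2/5 <
    9/22 = 1 - 13/22.\<close>
  have "exp (1 :: real) \<ge> 5 / 2"
    using exp_lower_Taylor_quadratic[of "1 :: real"] by simp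
  then have "exp (- 1) \<le> (2 / 5 :: real)"
    by (simp add: exp_minus field_simps)
  then show ?thesis
    using euler_mascheroni_less_13_over_22 by simp
qed

lemma energy_threshold_lower_bound:
  assumes "lam \<ge> 1" "\<tau> > 0" "eth > 0" "E1 (\<tau> / eth) = lam"
  shows "ln (eth / \<tau>) > lam + euler_mascheroni - 1"
proof -
  have "\<tau> / eth \<le> 1"
    using E1_less_one[of "\<tau> / eth"] assms by force
  then have "lam \<le> exp (- 1) - ln (\<tau> / eth)"
    using E1_le_exp_minus_ln[of "\<tau> / eth"] assms by simp
  then show ?thesis
    using exp_minus_one_less assms by (simp add: ln_div)
qed

section \<open>Sign and monotonicity of the water level denominator\<close>

definition level_denominator :: "real \<Rightarrow> real \<Rightarrow> real \<Rightarrow> real \<Rightarrow> real \<Rightarrow> real" where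
  "level_denominator lam \<alpha> \<tau> q e = (euler_mascheroni + lam - ln (e / \<tau>)) / \<alpha> - q / e"

text \<open>Below \<open>eth\<close> the water level is \<open>e\<close> divided by this difference,
  so the factorization cancels \<open>e\<close>; it also ties the sign of the denominator to the
  side of the critical queue.\<close>

lemma critical_queue_minus:
  assumes "e > 0"
  shows "critical_queue lam \<alpha> \<tau> e - q = e * level_denominator lam \<alpha> \<tau> q e"
  using assms by (simp add: critical_queue_def level_denominator_def right_diff_distrib diff_divide_distrib)

lemma level_denominator_pos_iff:
  assumes "e > 0"
  shows "level_denominator lam \<alpha> \<tau> q e > 0 \<longleftrightarrow> q < critical_queue lam \<alpha> \<tau> e"
  using assms critical_queue_minus[OF assms, of lam \<alpha> \<tau> q]
  by (metis diff_gt_0_iff_gt zero_less_mult_pos mult_pos_pos)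

lemma level_denominator_less_queue:
  assumes "e > 0" "q1 < q2"
  shows "level_denominator lam \<alpha> \<tau> q2 e < level_denominator lam \<alpha> \<tau> q1 e"
  using assms by (simp add: level_denominator_def divide_strict_right_mono)

text \<open>An exact increment replaces the derivative \<open>q / e^2 - 1 / (\<alpha> * e)\<close>;
  its sign then follows from \<open>ln x \<le> x - 1\<close>.\<close>

lemma level_denominator_diff:
  assumes "\<tau> > 0" "0 < e1" "0 < e2"
  shows "level_denominator lam \<alpha> \<tau> q e2 - level_denominator lam \<alpha> \<tau> q e1 =
    q * (e2 - e1) / (e1 * e2) - ln (e2 / e1) / \<alpha>"
proof -
  have "q * (e2 - e1) / (e1 * e2) = q / e1 - q / e2"
    using assms by (simp add: field_simps)
  moreover have "ln (e2 / e1) = ln (e2 / \<tau>) - ln (e1 / \<tau>)"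
    using assms by (simp add: ln_div)
  ultimately show ?thesis
    by (simp add: level_denominator_def diff_divide_distrib add_divide_distrib)
qed

text \<open>Taking \<open>x = e2 / e1\<close> in \<open>ln x \<le> x - 1\<close> compares
  \<open>q\<close> with \<open>e2 / \<alpha>\<close>, where \<open>e2\<close> is the endpoint nearer
  to \<open>\<alpha> * q\<close>.\<close>

lemma level_denominator_less_energy_low:
  assumes "\<alpha> > 0" "\<tau> > 0" "0 < e1" "e1 < e2" "e2 < \<alpha> * q"
  shows "level_denominator lam \<alpha> \<tau> q e1 < level_denominator lam \<alpha> \<tau> q e2"
proof -
  have "ln (e2 / e1) \<le> e2 / e1 - 1"
    using assms by (intro ln_le_minus_one) simp
  then have "ln (e2 / e1) / \<alpha> \<le> (e2 / e1 - 1) / \<alpha>"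
    using assms by (intro divide_right_mono) auto
  also have "\<dots> = (e2 / \<alpha>) * ((e2 - e1) / (e1 * e2))"
    using assms by (simp add: field_simps)
  also have "\<dots> < q * ((e2 - e1) / (e1 * e2))"
    using assms by (intro mult_strict_right_mono) (auto simp: field_simps)
  finally show ?thesis
    using level_denominator_diff[of \<tau> e1 e2 lam \<alpha> q] assms by simp
qed

text \<open>The logarithm now needs a lower bound, so \<open>x = e1 / e2\<close> is used;
  \<open>q\<close> is compared with \<open>e1 / \<alpha>\<close>, again the nearer endpoint.\<close>

lemma level_denominator_less_energy_high:
  assumes "\<alpha> > 0" "\<tau> > 0" "0 < e1" "e1 < e2" "\<alpha> * q < e1"
  shows "level_denominator lam \<alpha> \<tau> q e2 < level_denominator lam \<alpha> \<tau> q e1"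
proof -
  have "q * ((e2 - e1) / (e1 * e2)) < (e1 / \<alpha>) * ((e2 - e1) / (e1 * e2))"
    using assms by (intro mult_strict_right_mono) (auto simp: field_simps)
  also have "\<dots> = (1 - e1 / e2) / \<alpha>"
    using assms by (simp add: field_simps)
  also have "\<dots> \<le> ln (e2 / e1) / \<alpha>"
  proof (intro divide_right_mono)
    have "ln (e1 / e2) \<le> e1 / e2 - 1"
      using assms by (intro ln_le_minus_one) simp
    then show "1 - e1 / e2 \<le> ln (e2 / e1)"
      using assms by (simp add: ln_div)
  qed (use assms in simp)
  finally show ?thesis
    using level_denominator_diff[of \<tau> e1 e2 lam \<alpha> q] assms by simp
qed

section \<open>Partial derivatives of the priority function\<close>

text \<open>Differentiating the logarithm cancels the constant 1 in the bracket of
  \<open>V_low\<close>; what remains vanishes exactly at the critical queue.\<close>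

lemma V_low_has_derivative_energy:
  assumes "lam > 0" "\<alpha> > 0" "\<tau> > 0" "e > 0"
  shows "((\<lambda>e. V_low lam \<alpha> \<tau> q e) has_real_derivative
    (critical_queue lam \<alpha> \<tau> e - q) / (lam * \<alpha> * \<tau>)) (at e)"
proof -
  have "lam \<noteq> 0" "\<alpha> \<noteq> 0" "\<tau> \<noteq> 0" "e \<noteq> 0" "e / \<tau> > 0"
    using assms by auto
  then show ?thesis
    unfolding V_low_def critical_queue_def
    by (auto intro!: derivative_eq_intros simp: field_simps power2_eq_square)
qed

lemma V_low_has_derivative_queue:
  assumes "lam > 0" "\<alpha> > 0" "\<tau> > 0"
  shows "((\<lambda>q. V_low lam \<alpha> \<tau> q e) has_real_derivative - e / (lam * \<alpha> * \<tau>)) (at q)"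
  using assms unfolding V_low_def by (auto intro!: derivative_eq_intros)

lemma dV_dq_priority_function:
  assumes "lam > 0" "\<alpha> > 0" "\<tau> > 0"
    and "priority_function lam \<alpha> \<tau> eth V" "q \<ge> 0" "0 < e" "e < eth"
  shows "dV_dq V q e = - e / (lam * \<alpha> * \<tau>)"
  unfolding dV_dq_def
proof (rule right_deriv_eqI)
  show "((\<lambda>q'. V q' e) has_real_derivative - e / (lam * \<alpha> * \<tau>)) (at q within {q..})"
    by (rule has_field_derivative_transform_within[OF
          has_field_derivative_at_within[OF V_low_has_derivative_queue]
          zero_less_one])
       (use assms in \<open>auto simp: priority_function_def\<close>)
qed

lemma dV_de_priority_function:
  assumes "lam > 0" "\<alpha> > 0" "\<tau> > 0"
    and "priority_function lam \<alpha> \<tau> eth V" "q \<ge> 0" "0 < e" "e < eth"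
  shows "dV_de V q e = (critical_queue lam \<alpha> \<tau> e - q) / (lam * \<alpha> * \<tau>)"
  unfolding dV_de_def
proof (rule right_deriv_eqI)
  show "(V q has_real_derivative (critical_queue lam \<alpha> \<tau> e - q) / (lam * \<alpha> * \<tau>))
    (at e within {e..})"
    \<comment> \<open>Radius \<open>eth - e\<close> keeps the right neighbourhood where
      \<open>V\<close> equals \<open>V_low\<close>.\<close>
    by (rule has_field_derivative_transform_within[where d = "eth - e", OF
          has_field_derivative_at_within[OF V_low_has_derivative_energy]])
       (use assms in \<open>auto simp: priority_function_def dist_real_def\<close>)
qed

text \<open>To the right of any \<open>e \<ge> eth\<close>, including \<open>eth\<close> itself,
  \<open>V q\<close> is constant.\<close>

lemma dV_de_above_threshold:
  assumes "priority_function lam \<alpha> \<tau> eth V" "q \<ge> 0" "eth \<le> e"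
  shows "dV_de V q e = 0"
  unfolding dV_de_def
proof (rule right_deriv_eqI)
  obtain g where g: "\<And>e'. e' \<ge> eth \<Longrightarrow> V q e' = g q"
    using assms unfolding priority_function_def by blast
  show "(V q has_real_derivative 0) (at e within {e..})"
    by (rule has_field_derivative_transform_within[where f = "\<lambda>_. g q" and d = 1])
       (use assms g in auto)
qed

section \<open>Water level and power control\<close>

lemma water_level_below_threshold:
  assumes "lam > 0" "\<alpha> > 0" "\<tau> > 0"
    and "priority_function lam \<alpha> \<tau> eth V" "q \<ge> 0" "0 < e" "e < eth"
    and "q \<noteq> critical_queue lam \<alpha> \<tau> e"
  shows "water_level V q e = ereal (1 / level_denominator lam \<alpha> \<tau> q e)"
proof -
  \<comment> \<open>This rules out the zero derivative, for which the water level is infinite by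
    convention.\<close>
  have "level_denominator lam \<alpha> \<tau> q e \<noteq> 0"
    using critical_queue_minus[of e lam \<alpha> \<tau> q] assms by auto
  then show ?thesis
    using assms
    by (simp add: water_level_def dV_dq_priority_function dV_de_priority_function
        critical_queue_minus)
qed

text \<open>Reciprocals reverse the order of positive denominators. Two arbitrary points are
  allowed, to cover changes in \<open>q\<close> and in \<open>e\<close> alike.\<close>

lemma water_level_less:
  assumes "lam > 0" "\<alpha> > 0" "\<tau> > 0" "priority_function lam \<alpha> \<tau> eth V"
    and "q1 \<ge> 0" "0 < e1" "e1 < eth" "q1 < critical_queue lam \<alpha> \<tau> e1"
    and "q2 \<ge> 0" "0 < e2" "e2 < eth" "q2 < critical_queue lam \<alpha> \<tau> e2"
    and "level_denominator lam \<alpha> \<tau> q2 e2 < level_denominator lam \<alpha> \<tau> q1 e1"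
  shows "water_level V q1 e1 < water_level V q2 e2"
proof -
  have "level_denominator lam \<alpha> \<tau> q2 e2 > 0"
    using assms by (simp add: level_denominator_pos_iff)
  then have "1 / level_denominator lam \<alpha> \<tau> q1 e1 < 1 / level_denominator lam \<alpha> \<tau> q2 e2"
    using assms(13) by (intro divide_strict_left_mono) auto
  then show ?thesis
    using assms by (simp add: water_level_below_threshold)
qed

lemma power_control_water_level_neg:
  assumes "water_level V q e = ereal w" "w < 0" "\<tau> > 0" "e > 0"
  shows "power_control V \<tau> h q e = 0"
proof -
  have "water_level V q e - 1 / ereal ((cmod h)\<^sup>2) \<le> 0"
  proof (cases "h = 0")
    case True
    then show ?thesis
      using assms by (simp add: divide_ereal_def)
  next
    case False
    then have "w - 1 / (cmod h)\<^sup>2 \<le> 0"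
      using assms by (simp add: order.trans[of w 0])
    then show ?thesis
      using False assms by (simp add: one_ereal_def)
  qed
  \<comment> \<open>The positive part is 0, and the cap \<open>e / \<tau>\<close> is
    positive.\<close>
  then show ?thesis
    using assms by (simp add: power_control_def max_absorb2 min_def)
qed

lemma power_control_water_level_infinity:
  assumes "water_level V q e = \<infinity>"
  shows "power_control V \<tau> h q e = ereal (e / \<tau>)"
proof -
  have "water_level V q e - 1 / ereal ((cmod h)\<^sup>2) = \<infinity>"
    using assms by (simp add: ereal_minus_eq_PInfty_iff)
  then show ?thesis
    by (simp add: power_control_def)
qed

section \<open>The region of part (2) and the four structural claims\<close>

lemma below_threshold_if_high_queue:
  assumes "lam \<ge> 1" "\<alpha> > 0" "\<tau> > 0" "eth > 0" "E1 (\<tau> / eth) = lam"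
    and "0 < e" "e < \<alpha> * q" "q < critical_queue lam \<alpha> \<tau> e"
  shows "e < eth"
proof -
  \<comment> \<open>\<open>q\<close> lies strictly between the two sides.\<close>
  have "e / \<alpha> * 1 < e / \<alpha> * (euler_mascheroni + lam - ln (e / \<tau>))"
    using assms by (simp add: critical_queue_def field_simps)
  then have "1 < euler_mascheroni + lam - ln (e / \<tau>)"
    using assms by (subst (asm) mult_less_cancel_left_pos) auto
  also have "\<dots> < 1 + ln (eth / \<tau>) - ln (e / \<tau>)"
    using energy_threshold_lower_bound assms by fastforce
  finally show ?thesis
    using assms by (simp add: ln_div)
qed

theorem corollary2:
  shows "\<exists>lam0 \<alpha>0. \<forall>lam \<alpha> \<tau> N\<^sub>E eth :: real. \<forall>V :: real \<Rightarrow> real \<Rightarrow> real.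
    lam > 0 \<and> \<alpha> > 0 \<and> \<tau> > 0 \<and> N\<^sub>E > 0 \<and>
    lam \<ge> lam0 \<and> \<alpha> \<ge> \<alpha>0 \<and> large_arrival_energy_sufficient lam \<alpha> \<and>
    eth > 0 \<and> E1 (\<tau> / eth) = lam \<and>
    priority_function lam \<alpha> \<tau> eth V
    \<longrightarrow>
    (\<forall>h q e. q \<ge> 0 \<and> 0 < e \<and> e \<le> N\<^sub>E \<and> e < eth \<and> q > critical_queue lam \<alpha> \<tau> e
       \<longrightarrow> power_control V \<tau> h q e = 0) \<and>
    ((\<forall>e. 0 < e \<and> e \<le> N\<^sub>E \<longrightarrow>
        strict_mono_on {q. q \<ge> 0 \<and> e < \<alpha> * q \<and> q < critical_queue lam \<alpha> \<tau> e}
          (\<lambda>q. water_level V q e)) \<and>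
     (\<forall>q\<ge>0.
        strict_antimono_on {e. 0 < e \<and> e \<le> N\<^sub>E \<and> e < \<alpha> * q \<and> q < critical_queue lam \<alpha> \<tau> e}
          (\<lambda>e. water_level V q e))) \<and>
    ((\<forall>e. 0 < e \<and> e \<le> N\<^sub>E \<and> e < eth \<longrightarrow>
        strict_mono_on {q. q \<ge> 0 \<and> \<alpha> * q < e \<and> q < critical_queue lam \<alpha> \<tau> e}
          (\<lambda>q. water_level V q e)) \<and>
     (\<forall>q\<ge>0.
        strict_mono_on {e. e \<le> N\<^sub>E \<and> \<alpha> * q < e \<and> e < eth \<and> q < critical_queue lam \<alpha> \<tau> e}
          (\<lambda>e. water_level V q e))) \<and>
    (\<forall>h q e. q \<ge> 0 \<and> eth \<le> e \<and> e \<le> N\<^sub>E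
       \<longrightarrow> power_control V \<tau> h q e = ereal (e / \<tau>))"
\<comment> \<open>The bound 1 on \<open>lam\<close> is the one in
  \<open>below_threshold_if_high_queue\<close>; for \<open>\<alpha>\<close> the estimates use
  positivity, so 0 serves.\<close>
proof (rule exI[of _ 1], rule exI[of _ 0], intro allI impI, elim conjE)
  fix lam \<alpha> \<tau> N\<^sub>E eth :: real and V :: "real \<Rightarrow> real \<Rightarrow> real"
  assume pos: "lam > 0" "\<alpha> > 0" "\<tau> > 0"
    and lam: "lam \<ge> 1" and eth: "eth > 0" "E1 (\<tau> / eth) = lam"
    and V: "priority_function lam \<alpha> \<tau> eth V"
  note below = below_threshold_if_high_queue[OF lam pos(2,3) eth]
  note less = water_level_less[OF pos V]
  have part1: "power_control V \<tau> h q e = 0"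
    if "q \<ge> 0" "0 < e" "e < eth" "q > critical_queue lam \<alpha> \<tau> e" for h q e
  proof (rule power_control_water_level_neg)
    show "water_level V q e = ereal (1 / level_denominator lam \<alpha> \<tau> q e)"
      using that by (intro water_level_below_threshold[OF pos V]) auto
    \<comment> \<open>Above the critical queue the water level is finite and negative.\<close>
    have "e * level_denominator lam \<alpha> \<tau> q e < 0"
      using that critical_queue_minus[of e lam \<alpha> \<tau> q] by simp
    then show "1 / level_denominator lam \<alpha> \<tau> q e < 0"
      using that by (simp add: mult_less_0_iff)
  qed (use that pos in auto)
  have part2: "strict_mono_on {q. q \<ge> 0 \<and> e < \<alpha> * q \<and> q < critical_queue lam \<alpha> \<tau> e}
      (\<lambda>q. water_level V q e)" if "0 < e" for e
    by (rule strict_mono_onI) (use that below in \<open>auto intro!: less level_denominator_less_queue\<close>)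
  have part2': "strict_antimono_on
      {e. 0 < e \<and> e \<le> N\<^sub>E \<and> e < \<alpha> * q \<and> q < critical_queue lam \<alpha> \<tau> e}
      (\<lambda>e. water_level V q e)" if "q \<ge> 0" for q
  proof (rule monotone_onI)
    show "water_level V q e2 < water_level V q e1"
      if "e1 \<in> {e. 0 < e \<and> e \<le> N\<^sub>E \<and> e < \<alpha> * q \<and> q < critical_queue lam \<alpha> \<tau> e}"
        "e2 \<in> {e. 0 < e \<and> e \<le> N\<^sub>E \<and> e < \<alpha> * q \<and> q < critical_queue lam \<alpha> \<tau> e}"
        "e1 < e2" for e1 e2
      using that \<open>q \<ge> 0\<close> pos below[of e1 q] below[of e2 q]
      by (intro less level_denominator_less_energy_low) auto
  qed
  have part3: "strict_mono_on {q. q \<ge> 0 \<and> \<alpha> * q < e \<and> q < critical_queue lam \<alpha> \<tau> e}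
      (\<lambda>q. water_level V q e)" if "0 < e" "e < eth" for e
    by (rule strict_mono_onI) (use that in \<open>auto intro!: less level_denominator_less_queue\<close>)
  have part3': "strict_mono_on
      {e. e \<le> N\<^sub>E \<and> \<alpha> * q < e \<and> e < eth \<and> q < critical_queue lam \<alpha> \<tau> e}
      (\<lambda>e. water_level V q e)" if "q \<ge> 0" for q
  proof (rule strict_mono_onI)
    \<comment> \<open>The set does not list \<open>0 < e\<close>; it follows from
      \<open>\<alpha> * q \<ge> 0\<close>.\<close>
    have "e > 0" if "\<alpha> * q < e" for e
      using that \<open>q \<ge> 0\<close> pos(2) by (meson le_less_trans mult_nonneg_nonneg less_imp_le)
    then show "water_level V q e1 < water_level V q e2"
      if "e1 \<in> {e. e \<le> N\<^sub>E \<and> \<alpha> * q < e \<and> e < eth \<and> q < critical_queue lam \<alpha> \<tau> e}"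
        "e2 \<in> {e. e \<le> N\<^sub>E \<and> \<alpha> * q < e \<and> e < eth \<and> q < critical_queue lam \<alpha> \<tau> e}"
        "e1 < e2" for e1 e2
      using that \<open>q \<ge> 0\<close> pos by (auto intro!: less level_denominator_less_energy_high)
  qed
  have part4: "power_control V \<tau> h q e = ereal (e / \<tau>)" if "q \<ge> 0" "eth \<le> e" for h q e
    \<comment> \<open>The zero derivative makes the water level infinite, so the cap
      \<open>e / \<tau>\<close> is attained.\<close>
    using dV_de_above_threshold[OF V that]
    by (intro power_control_water_level_infinity) (simp add: water_level_def)
  show "(\<forall>h q e. q \<ge> 0 \<and> 0 < e \<and> e \<le> N\<^sub>E \<and> e < eth \<and> q > critical_queue lam \<alpha> \<tau> e
       \<longrightarrow> power_control V \<tau> h q e = 0) \<and>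
    ((\<forall>e. 0 < e \<and> e \<le> N\<^sub>E \<longrightarrow>
        strict_mono_on {q. q \<ge> 0 \<and> e < \<alpha> * q \<and> q < critical_queue lam \<alpha> \<tau> e}
          (\<lambda>q. water_level V q e)) \<and>
     (\<forall>q\<ge>0.
        strict_antimono_on {e. 0 < e \<and> e \<le> N\<^sub>E \<and> e < \<alpha> * q \<and> q < critical_queue lam \<alpha> \<tau> e}
          (\<lambda>e. water_level V q e))) \<and>
    ((\<forall>e. 0 < e \<and> e \<le> N\<^sub>E \<and> e < eth \<longrightarrow>
        strict_mono_on {q. q \<ge> 0 \<and> \<alpha> * q < e \<and> q < critical_queue lam \<alpha> \<tau> e}
          (\<lambda>q. water_level V q e)) \<and>
     (\<forall>q\<ge>0.
        strict_mono_on {e. e \<le> N\<^sub>E \<and> \<alpha> * q < e \<and> e < eth \<and> q < critical_queue lam \<alpha> \<tau> e}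
          (\<lambda>e. water_level V q e))) \<and>
    (\<forall>h q e. q \<ge> 0 \<and> eth \<le> e \<and> e \<le> N\<^sub>E
       \<longrightarrow> power_control V \<tau> h q e = ereal (e / \<tau>))"
    using part1 part2 part2' part3 part3' part4 by blast
qed

end
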